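(* Let $T(x)=\frac{1}{n^3}\left(\sum_{i=1}^n x_i\right)^4$, and for $\beta>0$ consider the tensor Curie–Weiss probability measure on $\{-1,1\}^n$, $$\mu_\beta(x)\propto\exp(\beta T(x)).$$ Suppose that $\beta\gtrsim0.50425$. Then the mixing time of Glauber dynamics associated with $\mu_\beta$ is at least exponential.
   Context: Here $\beta\gtrsim 0.50425$ means that $\beta$ exceeds a threshold whose numerical value is approximately $0.50425$, and "exponential" refers to growth in the dimension $n$. Glauber dynamics for a probability measure $\mu$ on $\{-1,1\}^n$ is the Markov chain which at each update picks a coordinate $i\in\{1,\dots,n\}$ uniformly at random and resamples $x_i$ from the conditional distribution under $\mu$ given $(x_j)_{j\ne i}$. With $P^t(x,\cdot)$ the law of the chain at time $t$ started from $x$, the mixing time is $t_{\mathrm{mix}}(\varepsilon)=\min\{t\ge0:\ \forall x\in\{-1,1\}^n,\ \|P^t(x,\cdot)-\mu\|_{\mathrm{TV}}\le\varepsilon\}$. $\propto$ means equality up to a positive normalizing constant independent of $x$. *)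

theory Defs
  imports "HOL-Probability.Probability"
begin

definition spins :: "nat \<Rightarrow> (nat \<Rightarrow> real) set" where
  "spins n = {1..n} \<rightarrow>\<^sub>E {-1, 1}"

definition energy :: "nat \<Rightarrow> (nat \<Rightarrow> real) \<Rightarrow> real" where
  "energy n x = (1 / real n ^ 3) * (\<Sum>i=1..n. x i) ^ 4"

definition partition_fun :: "nat \<Rightarrow> real \<Rightarrow> real" where
  "partition_fun n \<beta> = (\<Sum>x\<in>spins n. exp (\<beta> * energy n x))"

definition tensor_curie_weiss :: "nat \<Rightarrow> real \<Rightarrow> (nat \<Rightarrow> real) pmf" where
  "tensor_curie_weiss n \<beta> =
     embed_pmf (\<lambda>x. if x \<in> spins n then exp (\<beta> * energy n x) / partition_fun n \<beta> else 0)"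

lemma finite_spins: "finite (spins n)"
  unfolding spins_def by (intro finite_PiE) auto

lemma spins_nonempty: "spins n \<noteq> {}"
  unfolding spins_def by (simp add: PiE_eq_empty_iff)

lemma partition_fun_pos: "partition_fun n \<beta> > 0"
  unfolding partition_fun_def by (intro sum_pos finite_spins spins_nonempty) auto

lemma pmf_tensor_curie_weiss:
  "pmf (tensor_curie_weiss n \<beta>) x =
     (if x \<in> spins n then exp (\<beta> * energy n x) / partition_fun n \<beta> else 0)"
proof -
  let ?f = "\<lambda>x. if x \<in> spins n then exp (\<beta> * energy n x) / partition_fun n \<beta> else 0"
  have nn: "?f x \<ge> 0" for x
    using partition_fun_pos[of n \<beta>] by auto
  have "(\<integral>\<^sup>+ x. ennreal (?f x) \<partial>count_space UNIV) = (\<Sum>x\<in>spins n. ennreal (?f x))"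
    by (intro nn_integral_count_space'[OF finite_spins]) auto
  also have "\<dots> = ennreal (\<Sum>x\<in>spins n. ?f x)"
    by (intro sum_ennreal nn)
  also have "(\<Sum>x\<in>spins n. ?f x) = 1"
    using partition_fun_pos[of n \<beta>]
    by (simp add: sum_divide_distrib[symmetric] partition_fun_def[symmetric])
  finally show ?thesis
    unfolding tensor_curie_weiss_def by (subst pmf_embed_pmf) (use nn in auto)
qed

text \<open>Resampling coordinate \<open>i\<close> from its conditional law is the same as drawing a whole
  configuration from \<open>\<mu>\<close> conditioned on agreeing with \<open>x\<close> off \<open>i\<close>. The conditioning event must
  have positive probability, which holds for \<open>x\<close> in the support of \<open>\<mu>\<close>.\<close>

definition glauber :: "nat \<Rightarrow> (nat \<Rightarrow> real) pmf \<Rightarrow> (nat \<Rightarrow> real) \<Rightarrow> (nat \<Rightarrow> real) pmf" where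
  "glauber n \<mu> x =
     bind_pmf (pmf_of_set {1..n}) (\<lambda>i. cond_pmf \<mu> {y. \<forall>j\<in>{1..n} - {i}. y j = x j})"

primrec law_at :: "('a \<Rightarrow> 'a pmf) \<Rightarrow> nat \<Rightarrow> 'a \<Rightarrow> 'a pmf" where
  "law_at K 0 x = return_pmf x"
| "law_at K (Suc t) x = bind_pmf (law_at K t x) K"

definition tv_dist :: "'a pmf \<Rightarrow> 'a pmf \<Rightarrow> real" where
  "tv_dist p q = (SUP A. \<bar>measure_pmf.prob p A - measure_pmf.prob q A\<bar>)"

text \<open>The value is \<open>\<infinity>\<close> if the chain never comes within distance \<open>\<epsilon>\<close> from all starting points.\<close>

definition mixing_time :: "'a set \<Rightarrow> ('a \<Rightarrow> 'a pmf) \<Rightarrow> 'a pmf \<Rightarrow> real \<Rightarrow> enat" where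
  "mixing_time S K \<mu> \<epsilon> = Inf {enat t | t. \<forall>x\<in>S. tv_dist (law_at K t x) \<mu> \<le> \<epsilon>}"

text \<open>With \<open>n m\<close> the sum of the spins, the probability that the mean spin is \<open>m\<close> is, to exponential
  order, \<open>exp (n \<phi>(m))\<close> up to normalization, where
  \<open>\<phi>(m) = \<beta> m^4 - (1 + m)/2 * ln (1 + m) - (1 - m)/2 * ln (1 - m)\<close>, and
  \<open>\<phi>'(m) = 4 \<beta> m^3 - artanh m\<close>. So \<open>\<phi>\<close> decreases on \<open>[0, 1)\<close> for \<open>\<beta>\<close> up to the threshold below,
  and has a second local maximum in \<open>(0, 1)\<close> for larger \<open>\<beta>\<close>. This local maximum need not be global
  (it is not until about \<open>\<beta> = 0.689\<close>).\<close>

definition \<beta>_threshold :: real where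
  "\<beta>_threshold = (INF m\<in>{0<..<1}. artanh m / (4 * m ^ 3))"

lemma threshold_upper: "artanh (8894/10000::real) / (4*(8894/10000)^3) \<le> 0.504254"
proof -
  have "ln (2::real) \<le> 0.69314719" using ln_approx_bounds[of 2 8] by (simp add: eval_nat_numeral)
  moreover have "ln (18894/17696::real) \<le> 0.065507" 
    using ln_approx_bounds[of "18894/17696" 3] by (simp add: eval_nat_numeral)
  moreover have "ln (18894/1106::real) = 4 * ln 2 + ln (18894/17696)"
    using ln_mult[of "2^4::real" "18894/17696"] ln_realpow[of "2::real" 4] by simp
  ultimately show ?thesis by (simp add: artanh_def field_simps)
qed

lemma threshold_lower:
  assumes "0 < m" "m < (1::real)"
  shows "4 * 0.504246 * m^3 \<le> artanh m"
proof -
  define u0 :: real where "u0 = 0.889436^2"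
  define A where "A = 1 / (3 * u0 * (1 - u0))"
  define g where "g x = artanh x - A * x^3" for x :: real
  define g' where "g' x = (x^2 - u0) * (x^2 - (1 - u0)) / (u0 * (1 - u0) * (1 - x^2))" for x :: real
  define m1 where "m1 = sqrt (1 - u0)"
  have u0: "0.7 < u0" "u0 < 0.8" by (simp_all add: u0_def power2_eq_square)
  have m1: "0 < m1" "m1^2 = 1 - u0"
    using u0 by (auto simp: m1_def)
  have der: "(g has_real_derivative g' x) (at x)" if "0 \<le> x" "x < 1" for x
  proof -
    have x2: "x^2 < 1" using that by (simp add: power_less_one_iff abs_square_less_1)
    have "(g has_real_derivative (1 / (1 - x^2) - A * (3 * x^2))) (at x)"
      unfolding g_def using that by (auto intro!: derivative_eq_intros)
    moreover have "1 / (1 - x^2) - A * (3 * x^2) = g' x"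
      using u0 x2 by (simp add: A_def g'_def divide_simps) algebra
    ultimately show ?thesis by simp
  qed
  have den: "u0 * (1 - u0) * (1 - x^2) > 0" if "0 \<le> x" "x < 1" for x
    using that u0 by (intro mult_pos_pos) (auto simp: abs_square_less_1)
  have "ln (2::real) \<ge> 0.69314717" using ln_approx_bounds[of 2 8] by (simp add: eval_nat_numeral)
  moreover have "ln (1889436/1769024::real) \<ge> 0.06585038" 
    using ln_approx_bounds[of "1889436/1769024" 4] by (simp add: eval_nat_numeral)
  moreover have "ln (1889436/110564::real) = 4 * ln 2 + ln (1889436/1769024)"
    using ln_mult[of "2^4::real" "1889436/1769024"] ln_realpow[of "2::real" 4] by simp
  ultimately have g0: "g 0.889436 \<ge> 0"
    by (simp add: g_def A_def u0_def artanh_def field_simps power2_eq_square power3_eq_cube)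
  have "g m \<ge> 0"
  proof (cases "m \<le> m1")
    case True
    have "g 0 \<le> g m"
    proof (rule DERIV_nonneg_imp_nondecreasing[where f = g])
      fix x assume x: "0 \<le> x" "x \<le> m"
      then have "x^2 \<le> m1^2" using True by (intro power_mono) auto
      then have "g' x \<ge> 0" unfolding g'_def
        using den[of x] x assms u0 m1 by (intro divide_nonneg_pos mult_nonpos_nonpos) auto
      then show "\<exists>y. (g has_real_derivative y) (at x) \<and> 0 \<le> y"
        using der[of x] x assms by auto
    qed (use assms in auto)
    then show ?thesis by (simp add: g_def)
  next
    case False
    show ?thesis
    proof (cases "m \<le> 0.889436")
      case True
      have "g 0.889436 \<le> g m"
      proof (rule DERIV_nonpos_imp_nonincreasing[where f = g])
        fix x assume x: "m \<le> x" "x \<le> (0.889436::real)"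
        have "m1^2 \<le> x^2"
          using x False m1 by (intro power_mono) auto
        moreover have "x^2 \<le> u0"
          unfolding u0_def using x assms by (intro power_mono) auto
        ultimately have "g' x \<le> 0" unfolding g'_def
          using den[of x] x assms u0 m1 by (intro divide_nonpos_pos mult_nonpos_nonneg) auto
        then show "\<exists>y. (g has_real_derivative y) (at x) \<and> y \<le> 0"
          using der[of x] x assms by auto
      qed (use True in auto)
      then show ?thesis using g0 by simp
    next
      case False
      have "g 0.889436 \<le> g m"
      proof (rule DERIV_nonneg_imp_nondecreasing[where f = g])
        fix x assume x: "(0.889436::real) \<le> x" "x \<le> m"
        then have "u0 \<le> x^2" unfolding u0_def by (intro power_mono) auto
        then have "g' x \<ge> 0" unfolding g'_def
          using den[of x] x assms u0 m1 by (intro divide_nonneg_pos mult_nonneg_nonneg) auto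
        then show "\<exists>y. (g has_real_derivative y) (at x) \<and> 0 \<le> y"
          using der[of x] x assms by auto
      qed (use False in auto)
      then show ?thesis using g0 by simp
    qed
  qed
  moreover have "4 * 0.504246 \<le> A" by (simp add: A_def u0_def power2_eq_square)
  then have "4 * 0.504246 * m^3 \<le> A * m^3" using assms by (intro mult_right_mono) auto
  ultimately show ?thesis by (simp add: g_def)
qed

lemma \<beta>_threshold_approx: "\<bar>\<beta>_threshold - 0.50425\<bar> < 0.000005"
proof -
  have lb: "0.504246 \<le> artanh m / (4 * m^3)" if "m \<in> {0<..<1}" for m :: real
    using threshold_lower[of m] that by (simp add: field_simps)
  have "0.504246 \<le> \<beta>_threshold"
    unfolding \<beta>_threshold_def by (rule cINF_greatest) (use lb in auto)
  moreover have "\<beta>_threshold \<le> artanh (8894/10000) / (4 * (8894/10000)^3)"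
    unfolding \<beta>_threshold_def by (rule cINF_lower) (auto intro!: bdd_belowI2[OF lb])
  ultimately have "0.504246 \<le> \<beta>_threshold" "\<beta>_threshold \<le> 0.504254"
    using threshold_upper by (blast intro: order_trans)+
  then show ?thesis unfolding abs_less_iff by simp
qed

end

theory Submission
  imports Defs
begin

text \<open>Let \<open>A\<close> be the set of configurations with at least \<open>k\<close> spins equal to \<open>1\<close>, where
  \<open>k > n/2\<close>; by symmetry \<open>\<mu>(A) \<le> 1/2\<close>. A stationary chain started in \<open>A\<close> leaves it before time
  \<open>t\<close> with probability at most \<open>t \<mu>(B)\<close>, where \<open>B\<close> is the level with exactly \<open>k\<close> such spins, so
  mixing at time \<open>t\<close> forces \<open>(1/2 - \<epsilon>) \<mu>(A) \<le> t \<mu>(B)\<close>. Above the threshold there is \<open>m \<in> (0,1)\<close>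
  with \<open>4 \<beta> m^3 > artanh m\<close>. For mean spin in an interval \<open>[a, m]\<close> with \<open>a < m\<close> close to \<open>m\<close>, the ratio of the
  masses of consecutive levels is then at least a constant \<open>r > 1\<close>. With \<open>k\<close> at mean spin \<open>a\<close> this
  makes \<open>\<mu>(A) / \<mu>(B)\<close> exponentially large, without any use of Stirling's formula.\<close>

section \<open>Bottlenecks of stationary chains\<close>

lemma bind_law_at_stationary:
  assumes "bind_pmf \<mu> K = \<mu>"
  shows "bind_pmf \<mu> (law_at K t) = \<mu>"
proof (induction t)
  case (Suc t)
  have "law_at K (Suc t) = (\<lambda>x. bind_pmf (law_at K t x) K)" by (rule ext) simp
  then have "bind_pmf \<mu> (law_at K (Suc t)) = bind_pmf (bind_pmf \<mu> (law_at K t)) K"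
    by (simp only: bind_assoc_pmf)
  with Suc assms show ?case by (simp only:)
qed (simp add: bind_return_pmf')

lemma prob_bind_pmf:
  "measure_pmf.prob (bind_pmf p K) A = measure_pmf.expectation p (\<lambda>x. measure_pmf.prob (K x) A)"
proof -
  have "ennreal (measure_pmf.prob (bind_pmf p K) A) = (\<integral>\<^sup>+x. measure_pmf.prob (K x) A \<partial>p)"
    by (simp flip: measure_pmf.emeasure_eq_measure)
  also have "\<dots> = ennreal (measure_pmf.expectation p (\<lambda>x. measure_pmf.prob (K x) A))"
    by (intro nn_integral_eq_integral measure_pmf.integrable_const_bound[where B = 1]) auto
  finally show ?thesis by (simp add: integral_nonneg_AE)
qed

text \<open>Union bound over the exit time. By induction on \<open>t\<close>, mass found outside
  \<open>A\<close> after one more step was outside already or has just come from the inner boundary,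
  the points of \<open>A\<close> with a possible successor outside \<open>A\<close>.\<close>

lemma prob_exit_le:
  assumes "x \<in> A"
  shows "measure_pmf.prob (law_at K t x) (- A) \<le>
    (\<Sum>s<t. measure_pmf.prob (law_at K s x) {y \<in> A. \<not> set_pmf (K y) \<subseteq> A})"
proof (induction t)
  case 0
  with assms show ?case by simp
next
  case (Suc t)
  let ?B = "{y \<in> A. \<not> set_pmf (K y) \<subseteq> A}" and ?p = "law_at K t x"
  \<comment> \<open>Only points outside \<open>A\<close> or in the inner boundary can send mass
    outside; for these the trivial bound 1 suffices.\<close>
  have le: "measure_pmf.prob (K y) (- A) \<le> indicator (- A \<union> ?B) y" for y
  proof (cases "y \<in> - A \<union> ?B")
    case False
    then have "set_pmf (K y) \<inter> - A = {}" by auto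
    then have "measure_pmf.prob (K y) (- A) = 0"
      by (simp add: measure_pmf_zero_iff)
    then show ?thesis by simp
  qed simp
  have "measure_pmf.prob (law_at K (Suc t) x) (- A) =
      measure_pmf.expectation ?p (\<lambda>y. measure_pmf.prob (K y) (- A))"
    by (simp add: prob_bind_pmf)
  also have "\<dots> \<le> measure_pmf.expectation ?p (indicator (- A \<union> ?B))"
    by (intro integral_mono measure_pmf.integrable_const_bound[where B = 1] le) auto
  also have "\<dots> = measure_pmf.prob ?p (- A \<union> ?B)" by simp
  also have "\<dots> \<le> measure_pmf.prob ?p (- A) + measure_pmf.prob ?p ?B"
    by (intro measure_subadditive) auto
  finally show ?case using Suc by simp
qed

lemma prob_le_tv_dist:
  "\<bar>measure_pmf.prob p A - measure_pmf.prob q A\<bar> \<le> tv_dist p q"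
  unfolding tv_dist_def
proof (rule cSUP_upper)
  have "\<bar>measure_pmf.prob p A - measure_pmf.prob q A\<bar> \<le> 1" for A
    using measure_pmf.prob_le_1[of p A] measure_pmf.prob_le_1[of q A]
      measure_nonneg[of p A] measure_nonneg[of q A] by linarith
  then show "bdd_above (range (\<lambda>A. \<bar>measure_pmf.prob p A - measure_pmf.prob q A\<bar>))"
    by (rule bdd_aboveI2)
qed simp

text \<open>Integrate the exit bound against \<mu>: by stationarity each of the \<open>t\<close>
  times contributes the mass of the inner boundary. Conversely, a start in the support is in
  \<open>A\<close> at time \<open>t\<close> with probability at most
  \<open>1 / 2 + \<epsilon>\<close>, hence outside with probability at least
  \<open>1 / 2 - \<epsilon>\<close>.\<close>

lemma bottleneck_bound:
  assumes stat: "bind_pmf \<mu> K = \<mu>"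
    and mixed: "\<forall>x\<in>set_pmf \<mu>. tv_dist (law_at K t x) \<mu> \<le> \<epsilon>"
    and half: "measure_pmf.prob \<mu> A \<le> 1 / 2"
  shows "(1 / 2 - \<epsilon>) * measure_pmf.prob \<mu> A \<le>
    real t * measure_pmf.prob \<mu> {y \<in> A. \<not> set_pmf (K y) \<subseteq> A}"
proof -
  let ?B = "{y \<in> A. \<not> set_pmf (K y) \<subseteq> A}"
  let ?f = "\<lambda>x. \<Sum>s<t. measure_pmf.prob (law_at K s x) ?B"
  have int: "integrable \<mu> (\<lambda>x. measure_pmf.prob (law_at K s x) ?B)" for s
    by (intro measure_pmf.integrable_const_bound[where B = 1]) auto
  have "(1 / 2 - \<epsilon>) * indicator A x \<le> ?f x" if "x \<in> set_pmf \<mu>" for x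
  proof (cases "x \<in> A")
    case True
    have "\<bar>measure_pmf.prob (law_at K t x) A - measure_pmf.prob \<mu> A\<bar> \<le> \<epsilon>"
      using mixed that prob_le_tv_dist order_trans by blast
    with half have "1 / 2 - \<epsilon> \<le> 1 - measure_pmf.prob (law_at K t x) A" by linarith
    also have "\<dots> = measure_pmf.prob (law_at K t x) (- A)"
      using measure_pmf.prob_compl[of A "law_at K t x"] by (simp add: Compl_eq_Diff_UNIV)
    finally show ?thesis using prob_exit_le[OF True, of K t] True by simp
  qed (simp add: sum_nonneg)
  then have "measure_pmf.expectation \<mu> (\<lambda>x. (1 / 2 - \<epsilon>) * indicator A x)
      \<le> measure_pmf.expectation \<mu> ?f"
    by (intro integral_mono_AE Bochner_Integration.integrable_sum int integrable_mult_right
          measure_pmf.integrable_const_bound[where B = 1]) (auto simp: AE_measure_pmf_iff)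
  also have "measure_pmf.expectation \<mu> ?f =
      (\<Sum>s<t. measure_pmf.expectation \<mu> (\<lambda>x. measure_pmf.prob (law_at K s x) ?B))"
    by (intro Bochner_Integration.integral_sum int)
  also have "\<dots> = real t * measure_pmf.prob \<mu> ?B"
    by (simp add: bind_law_at_stationary[OF stat] flip: prob_bind_pmf)
  finally show ?thesis by simp
qed

text \<open>The infimum of a nonempty set of times is attained, so a bound for every mixed time
  passes to it; with no mixed time the value is \<infinity>.\<close>

lemma le_mixing_time:
  assumes "\<And>t. \<forall>x\<in>S. tv_dist (law_at K t x) \<mu> \<le> \<epsilon> \<Longrightarrow> c \<le> real t"
  shows "ereal c \<le> ereal_of_enat (mixing_time S K \<mu> \<epsilon>)"
proof (cases "\<exists>t. \<forall>x\<in>S. tv_dist (law_at K t x) \<mu> \<le> \<epsilon>")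
  case True
  let ?X = "{enat t | t. \<forall>x\<in>S. tv_dist (law_at K t x) \<mu> \<le> \<epsilon>}"
  have "?X \<noteq> {}" using True by blast
  then have "Inf ?X \<in> ?X" by (meson Inf_enat_def wellorder_InfI ex_in_conv)
  then obtain t where "Inf ?X = enat t" "\<forall>x\<in>S. tv_dist (law_at K t x) \<mu> \<le> \<epsilon>" by blast
  then show ?thesis using assms by (simp add: mixing_time_def)
next
  case False
  then have "mixing_time S K \<mu> \<epsilon> = \<infinity>"
    unfolding mixing_time_def by (simp add: Inf_enat_def)
  then show ?thesis by simp
qed

section \<open>Glauber dynamics\<close>

text \<open>For fixed \<open>i\<close>, agreeing off \<open>i\<close> is an equivalence relation,
  and redrawing from \<mu> within the class of a \<mu>-distributed point gives back \<mu>. Averaging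
  over \<open>i\<close> preserves this.\<close>

lemma glauber_stationary:
  fixes \<mu> :: "(nat \<Rightarrow> real) pmf"
  shows "bind_pmf \<mu> (glauber n \<mu>) = \<mu>"
proof -
  have "bind_pmf \<mu> (\<lambda>x. cond_pmf \<mu> {y. \<forall>j\<in>{1..n} - {i}. y j = x j}) = \<mu>" for i
  proof (rule bind_cond_pmf_cancel)
    fix x y :: "nat \<Rightarrow> real" assume "\<forall>j\<in>{1..n} - {i}. y j = x j"
    then show "measure_pmf.prob \<mu> {y. \<forall>j\<in>{1..n} - {i}. y j = x j} =
        measure_pmf.prob \<mu> {x. \<forall>j\<in>{1..n} - {i}. y j = x j}"
      by (intro arg_cong[where f = "measure_pmf.prob \<mu>"] Collect_cong ball_cong) auto
  qed auto
  then show ?thesis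
    unfolding glauber_def by (subst bind_commute_pmf) simp
qed

text \<open>For \<open>x\<close> in the support each conditioning event contains \<open>x\<close>
  and so has positive probability; \<open>n > 0\<close> makes the choice of a coordinate a genuine
  uniform law.\<close>

lemma set_pmf_glauber:
  assumes "x \<in> set_pmf \<mu>" "n > 0"
  shows "set_pmf (glauber n \<mu> x) = (\<Union>i\<in>{1..n}. {y \<in> set_pmf \<mu>. \<forall>j\<in>{1..n} - {i}. y j = x j})"
proof -
  have "set_pmf (cond_pmf \<mu> {y. \<forall>j\<in>{1..n} - {i}. y j = x j}) =
      {y \<in> set_pmf \<mu>. \<forall>j\<in>{1..n} - {i}. y j = x j}" for i
    using assms(1) by (subst set_cond_pmf) auto
  then show ?thesis using assms(2) by (simp add: glauber_def)
qed

section \<open>Levels of the tensor Curie--Weiss measure\<close>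

definition up :: "nat \<Rightarrow> (nat \<Rightarrow> real) \<Rightarrow> nat" where
  "up n x = card {i \<in> {1..n}. x i = 1}"

text \<open>Unnormalized mass of the level \<open>up n x = k\<close>, on which the spin sum is
  \<open>2 * k - n\<close>; dividing by \<open>partition_fun n \<beta>\<close> gives its
  probability.\<close>

definition level_weight :: "nat \<Rightarrow> real \<Rightarrow> nat \<Rightarrow> real" where
  "level_weight n \<beta> k = real (n choose k) * exp (\<beta> * ((2 * real k - real n) ^ 4 / real n ^ 3))"

lemma up_le: "up n x \<le> n"
proof -
  have "card {i \<in> {1..n}. x i = 1} \<le> card {1..n}" by (intro card_mono) auto
  then show ?thesis by (simp add: up_def)
qed

text \<open>This is what confines the exits from \<open>{x. k \<le> up n x}\<close> under
  single-spin updates to the level \<open>up n x = k\<close>.\<close>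

lemma up_le_Suc_if_agree:
  assumes "\<forall>j\<in>{1..n} - {i}. y j = x j"
  shows "up n x \<le> Suc (up n y)"
proof -
  have "{i \<in> {1..n}. x i = 1} \<subseteq> insert i {i \<in> {1..n}. y i = 1}" using assms by auto
  then have "up n x \<le> card (insert i {i \<in> {1..n}. y i = 1})"
    unfolding up_def by (intro card_mono) auto
  also have "\<dots> \<le> Suc (up n y)" unfolding up_def by (rule card_insert_le_m1) auto
  finally show ?thesis .
qed

lemma sum_spins:
  assumes "x \<in> spins n"
  shows "(\<Sum>i=1..n. x i) = 2 * real (up n x) - real n"
proof -
  have "x i = 2 * (if x i = 1 then 1 else 0) - 1" if "i \<in> {1..n}" for i
    using assms that by (auto simp: spins_def PiE_iff)
  then have "(\<Sum>i=1..n. x i) = (\<Sum>i=1..n. 2 * (if x i = 1 then 1 else 0) - 1)"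
    by (rule sum.cong[OF refl])
  also have "\<dots> = 2 * (\<Sum>i=1..n. if x i = 1 then 1 else 0) - real n"
    by (simp add: sum_subtractf sum_distrib_left)
  also have "(\<Sum>i=1..n. if x i = 1 then 1 else 0) = real (up n x)"
    by (simp add: up_def sum.If_cases Int_def)
  finally show ?thesis .
qed

lemma energy_spins:
  assumes "x \<in> spins n"
  shows "energy n x = (2 * real (up n x) - real n) ^ 4 / real n ^ 3"
  unfolding energy_def sum_spins[OF assms] by simp

lemma set_pmf_tensor_curie_weiss: "set_pmf (tensor_curie_weiss n \<beta>) = spins n"
  using partition_fun_pos[of n \<beta>] by (auto simp: set_pmf_eq pmf_tensor_curie_weiss)

text \<open>A configuration corresponds to its set of coordinates with spin 1; extensionality fixes
  its values outside \<open>{1..n}\<close>, so this is a bijection onto the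
  \<open>k\<close>-subsets.\<close>

lemma card_level: "card {x \<in> spins n. up n x = k} = n choose k"
proof -
  let ?L = "{x \<in> spins n. up n x = k}" and ?T = "{T. T \<subseteq> {1..n} \<and> card T = k}"
  let ?s = "\<lambda>T. \<lambda>i\<in>{1..n}. if i \<in> T then 1 else - 1 :: real"
  have "bij_betw (\<lambda>x. {i \<in> {1..n}. x i = 1}) ?L ?T"
  proof (rule bij_betw_byWitness[where f' = ?s])
    show "\<forall>x\<in>?L. ?s {i \<in> {1..n}. x i = 1} = x"
    proof
      fix x assume "x \<in> ?L"
      then have x: "x \<in> {1..n} \<rightarrow>\<^sub>E {-1, 1}" by (simp add: spins_def)
      show "?s {i \<in> {1..n}. x i = 1} = x"
      proof (rule extensionalityI[where A = "{1..n}"])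
        fix i assume "i \<in> {1..n}"
        moreover from this x have "x i \<in> {-1, 1}" by (rule PiE_mem[rotated])
        ultimately show "?s {i \<in> {1..n}. x i = 1} i = x i" by auto
      qed (use x in \<open>auto simp: PiE_def\<close>)
    qed
    show inv: "\<forall>T\<in>?T. {i \<in> {1..n}. ?s T i = 1} = T"
      by (auto split: if_splits)
    show "(\<lambda>x. {i \<in> {1..n}. x i = 1}) ` ?L \<subseteq> ?T" by (auto simp: up_def)
    have "?s T \<in> spins n" for T unfolding spins_def by auto
    then show "?s ` ?T \<subseteq> ?L" unfolding up_def using inv by force
  qed
  then show ?thesis using n_subsets[of "{1..n}" k] by (simp add: bij_betw_same_card)
qed

lemma prob_tensor_curie_weiss_level:
  "measure_pmf.prob (tensor_curie_weiss n \<beta>) {x \<in> spins n. up n x = k} =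
    level_weight n \<beta> k / partition_fun n \<beta>"
proof -
  let ?L = "{x \<in> spins n. up n x = k}"
  have "measure_pmf.prob (tensor_curie_weiss n \<beta>) ?L = (\<Sum>x\<in>?L. pmf (tensor_curie_weiss n \<beta>) x)"
    using finite_spins by (intro measure_measure_pmf_finite) auto
  also have "\<dots> = (\<Sum>x\<in>?L. exp (\<beta> * ((2 * real k - real n) ^ 4 / real n ^ 3)) / partition_fun n \<beta>)"
    by (intro sum.cong) (auto simp: pmf_tensor_curie_weiss energy_spins)
  finally show ?thesis by (simp add: card_level level_weight_def)
qed

text \<open>The energy is even in the spin sum, so exchanging level \<open>j\<close> with level
  \<open>n - j\<close> preserves mass. The image of the majority event is disjoint from it because
  \<open>n - k < k\<close>.\<close>

lemma prob_majority_le_half: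
  assumes "n < 2 * k" "k \<le> n"
  shows "measure_pmf.prob (tensor_curie_weiss n \<beta>) {x. k \<le> up n x} \<le> 1 / 2"
proof -
  let ?\<mu> = "tensor_curie_weiss n \<beta>" and ?A = "{x. k \<le> up n x}"
  let ?A' = "{x. up n x \<le> n - k}"
  have level: "measure_pmf.prob ?\<mu> {x \<in> spins n. up n x \<in> J} =
      (\<Sum>j\<in>J. level_weight n \<beta> j / partition_fun n \<beta>)" if "finite J" for J
  proof -
    have "{x \<in> spins n. up n x \<in> J} = (\<Union>j\<in>J. {x \<in> spins n. up n x = j})" by auto
    moreover have "measure_pmf.prob ?\<mu> (\<Union>j\<in>J. {x \<in> spins n. up n x = j}) =
        (\<Sum>j\<in>J. measure_pmf.prob ?\<mu> {x \<in> spins n. up n x = j})"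
      using that by (intro measure_pmf.finite_measure_finite_Union) (auto simp: disjoint_family_on_def)
    ultimately show ?thesis by (simp only: prob_tensor_curie_weiss_level)
  qed
  have sym: "level_weight n \<beta> (n - j) = level_weight n \<beta> j" if "j \<le> n" for j
  proof -
    have "2 * real (n - j) - real n = - (2 * real j - real n)" using that by (simp add: of_nat_diff)
    then have "(2 * real (n - j) - real n) ^ 4 = (2 * real j - real n) ^ 4"
      by (simp only: power_minus_even even_numeral)
    then show ?thesis
      using binomial_symmetric[OF that] unfolding level_weight_def by simp
  qed
  have "measure_pmf.prob ?\<mu> ?A = measure_pmf.prob ?\<mu> {x \<in> spins n. up n x \<in> {k..n}}"
    by (rule measure_prob_cong_0)
      (auto simp: up_le pmf_tensor_curie_weiss)
  also have "\<dots> = (\<Sum>j\<in>{k..n}. level_weight n \<beta> j / partition_fun n \<beta>)"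
    by (rule level) simp
  also have "\<dots> = (\<Sum>j\<in>{..n - k}. level_weight n \<beta> j / partition_fun n \<beta>)"
    using assms(2) by (intro sum.reindex_bij_witness[where i = "\<lambda>j. n - j" and j = "\<lambda>j. n - j"])
      (auto simp: sym)
  also have "\<dots> = measure_pmf.prob ?\<mu> {x \<in> spins n. up n x \<in> {..n - k}}"
    by (rule level[symmetric]) simp
  also have "\<dots> = measure_pmf.prob ?\<mu> ?A'"
    by (rule measure_prob_cong_0) (auto simp: pmf_tensor_curie_weiss)
  also have "\<dots> \<le> measure_pmf.prob ?\<mu> (- ?A)"
    using assms by (intro measure_pmf.finite_measure_mono) auto
  also have "\<dots> = 1 - measure_pmf.prob ?\<mu> ?A"
    using measure_pmf.prob_compl[of ?A ?\<mu>] by (simp add: Compl_eq_Diff_UNIV)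
  finally show ?thesis by simp
qed

text \<open>The ratio of consecutive weights is \<open>(n - j) / (j + 1)\<close> times the
  exponential of the increase of \<beta> times the energy. The upper limit \<open>m\<close> on the
  mean spin controls the first factor, the lower limit \<open>a\<close> the second. The logarithm of
  the resulting constant is \<open>2 * (4 * \<beta> * a ^ 3 - artanh m)\<close>, a discrete form of
  the derivative of the rate function.\<close>

lemma level_weight_Suc_ge:
  assumes "\<beta> > 0" "0 < a" "m < 1" "(1 + a) * real n \<le> 2 * real j" "2 * real (Suc j) \<le> (1 + m) * real n"
  shows "(1 - m) / (1 + m) * exp (8 * \<beta> * a ^ 3) * level_weight n \<beta> j \<le> level_weight n \<beta> (Suc j)"
proof -
  define s where "s = 2 * real j - real n"
  have n: "n > 0" using assms(5) by (cases n) auto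
  have s: "a * real n \<le> s" using assms(4) by (simp add: s_def algebra_simps)
  then have s0: "0 \<le> s" using assms(2) n by (smt (verit) mult_nonneg_nonneg of_nat_0_le_iff)
  have m: "0 < 1 + m" using assms(5) n
    by (smt (verit) mult_nonpos_nonneg of_nat_0_le_iff of_nat_Suc)
  have jn: "j < n"
  proof -
    have "(1 + m) * real n \<le> 2 * real n" using assms(3) by (intro mult_right_mono) auto
    with assms(5) show ?thesis by simp
  qed
  have "(1 - m) * (2 * real (Suc j)) \<le> (1 - m) * ((1 + m) * real n)"
    using assms by (intro mult_left_mono) auto
  also have "\<dots> \<le> (1 + m) * (2 * real (n - j))"
  proof -
    have "(1 - m) * real n \<le> 2 * real (n - j)"
      using assms(5) jn by (simp add: of_nat_diff algebra_simps)
    then have "(1 + m) * ((1 - m) * real n) \<le> (1 + m) * (2 * real (n - j))"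
      using m by (intro mult_left_mono) auto
    then show ?thesis by (simp add: algebra_simps)
  qed
  finally have "(1 - m) / (1 + m) * real (Suc j) \<le> real (n - j)"
    using m by (simp add: field_simps)
  then have "(1 - m) / (1 + m) * real (Suc j) * real (n choose j) \<le> real (n - j) * real (n choose j)"
    by (intro mult_right_mono) auto
  \<comment> \<open>Absorption identity for binomial coefficients; it avoids dividing them.\<close>
  also have "\<dots> = real (Suc j) * real (n choose Suc j)"
    by (metis Suc_times_binomial_eq binomial_absorb_comp binomial_absorption of_nat_mult)
  finally have "real (Suc j) * ((1 - m) / (1 + m) * real (n choose j)) \<le> real (Suc j) * real (n choose Suc j)"
    by (simp only: mult_ac)
  then have choose: "(1 - m) / (1 + m) * real (n choose j) \<le> real (n choose Suc j)"
    by (rule mult_left_le_imp_le) simp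
  have "(a * real n) ^ 3 \<le> s ^ 3" using s assms(2) by (intro power_mono) auto
  moreover have "(s + 2) ^ 4 - s ^ 4 = 8 * s ^ 3 + (24 * s ^ 2 + 32 * s + 16)"
    by algebra
  moreover have "0 \<le> 24 * s ^ 2 + 32 * s + 16" using s0 by simp
  ultimately have "8 * (a * real n) ^ 3 \<le> (s + 2) ^ 4 - s ^ 4" by linarith
  then have "8 * a ^ 3 \<le> ((s + 2) ^ 4 - s ^ 4) / real n ^ 3"
    using n by (simp add: field_simps power_mult_distrib)
  then have "8 * a ^ 3 + s ^ 4 / real n ^ 3 \<le> (s + 2) ^ 4 / real n ^ 3"
    by (simp add: diff_divide_distrib)
  then have "\<beta> * (8 * a ^ 3 + s ^ 4 / real n ^ 3) \<le> \<beta> * ((s + 2) ^ 4 / real n ^ 3)"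
    using assms(1) by (intro mult_left_mono) auto
  then have "exp (8 * \<beta> * a ^ 3) * exp (\<beta> * (s ^ 4 / real n ^ 3)) \<le> exp (\<beta> * ((s + 2) ^ 4 / real n ^ 3))"
    by (simp add: algebra_simps flip: exp_add)
  with choose have "((1 - m) / (1 + m) * real (n choose j)) *
      (exp (8 * \<beta> * a ^ 3) * exp (\<beta> * (s ^ 4 / real n ^ 3))) \<le>
      real (n choose Suc j) * exp (\<beta> * ((s + 2) ^ 4 / real n ^ 3))"
    by (intro mult_mono) auto
  moreover have "2 * real (Suc j) - real n = s + 2" by (simp add: s_def)
  ultimately show ?thesis
    unfolding level_weight_def s_def[symmetric] by (simp only: mult_ac)
qed

lemma level_weight_growth:
  assumes "\<And>j. k \<le> j \<Longrightarrow> Suc j \<le> l \<Longrightarrow> r * level_weight n \<beta> j \<le> level_weight n \<beta> (Suc j)"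
    and "k \<le> l" "r > 0"
  shows "r ^ (l - k) * level_weight n \<beta> k \<le> level_weight n \<beta> l"
  using assms(2,1)
proof (induction l rule: dec_induct)
  case (step j)
  have "r ^ (Suc j - k) * level_weight n \<beta> k = r * (r ^ (j - k) * level_weight n \<beta> k)"
    using step by (simp add: Suc_diff_le)
  also have "\<dots> \<le> r * level_weight n \<beta> j"
    using step assms(3) by (intro mult_left_mono) auto
  also have "\<dots> \<le> level_weight n \<beta> (Suc j)" using step by auto
  finally show ?case .
qed simp

text \<open>Apply the bottleneck bound to \<open>{x. k \<le> up n x}\<close>: its inner boundary
  lies in level \<open>k\<close>, while it contains level \<open>l\<close>, whose weight is at least
  \<open>r ^ (l - k)\<close> times that of level \<open>k\<close>. The partition function
  cancels.\<close>

lemma mixing_time_level_bound: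
  assumes "n > 0" "n < 2 * k" "k \<le> l" "l \<le> n" "r > 0" "\<epsilon> \<le> 1 / 2"
    and growth: "\<And>j. k \<le> j \<Longrightarrow> Suc j \<le> l \<Longrightarrow> r * level_weight n \<beta> j \<le> level_weight n \<beta> (Suc j)"
  shows "ereal ((1 / 2 - \<epsilon>) * r ^ (l - k)) \<le>
    ereal_of_enat (mixing_time (spins n) (glauber n (tensor_curie_weiss n \<beta>))
      (tensor_curie_weiss n \<beta>) \<epsilon>)"
proof (rule le_mixing_time)
  let ?\<mu> = "tensor_curie_weiss n \<beta>" and ?K = "glauber n (tensor_curie_weiss n \<beta>)"
  let ?A = "{x. k \<le> up n x}"
  let ?B = "{y \<in> ?A. \<not> set_pmf (?K y) \<subseteq> ?A}"
  let ?w = "level_weight n \<beta>"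
  fix t assume mixed: "\<forall>x\<in>spins n. tv_dist (law_at ?K t x) ?\<mu> \<le> \<epsilon>"
  have up: "up n x = k" if x: "x \<in> spins n" "x \<in> ?B" for x
  proof -
    from x obtain y where "y \<in> set_pmf (?K x)" "up n y < k"
      by (auto simp: subset_iff not_le)
    then obtain i where "\<forall>j\<in>{1..n} - {i}. y j = x j"
      using x(1) assms(1) by (auto simp: set_pmf_glauber set_pmf_tensor_curie_weiss)
    from up_le_Suc_if_agree[OF this] \<open>up n y < k\<close> x(2) show ?thesis by simp
  qed
  \<comment> \<open>The inclusion in level \<open>k\<close> was shown only for points of the support
    \<open>spins n\<close>.\<close>
  have "measure_pmf.prob ?\<mu> ?B = measure_pmf.prob ?\<mu> (?B \<inter> spins n)"
    by (simp add: measure_Int_set_pmf flip: set_pmf_tensor_curie_weiss[of n \<beta>])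
  also have "\<dots> \<le> measure_pmf.prob ?\<mu> {x \<in> spins n. up n x = k}"
    using up by (intro measure_pmf.finite_measure_mono) auto
  finally have B: "measure_pmf.prob ?\<mu> ?B \<le> ?w k / partition_fun n \<beta>"
    by (simp add: prob_tensor_curie_weiss_level)
  have "?w l / partition_fun n \<beta> = measure_pmf.prob ?\<mu> {x \<in> spins n. up n x = l}"
    by (simp add: prob_tensor_curie_weiss_level)
  also have "\<dots> \<le> measure_pmf.prob ?\<mu> ?A"
    using assms by (intro measure_pmf.finite_measure_mono) auto
  finally have A: "?w l / partition_fun n \<beta> \<le> measure_pmf.prob ?\<mu> ?A" .
  have "(1 / 2 - \<epsilon>) * (?w l / partition_fun n \<beta>) \<le> (1 / 2 - \<epsilon>) * measure_pmf.prob ?\<mu> ?A"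
    using A assms by (intro mult_left_mono) auto
  also have "\<dots> \<le> real t * measure_pmf.prob ?\<mu> ?B"
    using mixed assms
    by (intro bottleneck_bound glauber_stationary prob_majority_le_half)
      (auto simp: set_pmf_tensor_curie_weiss)
  also have "\<dots> \<le> real t * (?w k / partition_fun n \<beta>)" using B by (intro mult_left_mono) auto
  finally have "(1 / 2 - \<epsilon>) * ?w l / partition_fun n \<beta> \<le> real t * ?w k / partition_fun n \<beta>"
    by simp
  then have le: "(1 / 2 - \<epsilon>) * ?w l \<le> real t * ?w k"
    using partition_fun_pos[of n \<beta>] by (simp only: divide_le_cancel)
  have "(1 / 2 - \<epsilon>) * r ^ (l - k) * ?w k \<le> (1 / 2 - \<epsilon>) * ?w l"
    using level_weight_growth[OF growth] assms by (simp add: mult.assoc mult_left_mono)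
  with le have "(1 / 2 - \<epsilon>) * r ^ (l - k) * ?w k \<le> real t * ?w k" by linarith
  moreover have "?w k > 0" using assms by (simp add: level_weight_def)
  ultimately show "(1 / 2 - \<epsilon>) * r ^ (l - k) \<le> real t" by simp
qed

section \<open>The exponential lower bound\<close>

text \<open>As \<beta> exceeds the infimum, some \<open>m\<close> satisfies
  \<open>artanh m < 4 * \<beta> * m ^ 3\<close>; exponentiated, this is the last inequality at
  \<open>a = m\<close>. By continuity it survives for \<open>a\<close> slightly below
  \<open>m\<close>, which leaves an interval of positive length and hence linearly many
  levels.\<close>

lemma threshold_interval:
  assumes "\<beta> > \<beta>_threshold"
  obtains a m where "0 < a" "a < m" "m < 1" "1 < (1 - m) / (1 + m) * exp (8 * \<beta> * a ^ 3)"
proof -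
  obtain m where m: "0 < m" "m < 1" and "artanh m / (4 * m ^ 3) < \<beta>"
    using cInf_lessD[OF _ assms[unfolded \<beta>_threshold_def]] by auto
  then have "ln ((1 + m) / (1 - m)) < 8 * \<beta> * m ^ 3"
    by (simp add: artanh_def field_simps)
  then have "exp (ln ((1 + m) / (1 - m))) < exp (8 * \<beta> * m ^ 3)" by simp
  then have "(1 + m) / (1 - m) < exp (8 * \<beta> * m ^ 3)" using m by simp
  then have gt: "1 < (1 - m) / (1 + m) * exp (8 * \<beta> * m ^ 3)" using m by (simp add: field_simps)
  have "((\<lambda>a. (1 - m) / (1 + m) * exp (8 * \<beta> * a ^ 3)) \<longlongrightarrow> (1 - m) / (1 + m) * exp (8 * \<beta> * m ^ 3)) (at_left m)"
    using m by (intro tendsto_intros) auto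
  then have "\<forall>\<^sub>F a in at_left m. 1 < (1 - m) / (1 + m) * exp (8 * \<beta> * a ^ 3)"
    using gt by (rule order_tendstoD)
  moreover have "\<forall>\<^sub>F a in at_left m. a \<in> {0<..<m}" using m by (intro eventually_at_leftI) auto
  ultimately have "\<forall>\<^sub>F a in at_left m. a \<in> {0<..<m} \<and> 1 < (1 - m) / (1 + m) * exp (8 * \<beta> * a ^ 3)"
    by eventually_elim simp
  then obtain a where "a \<in> {0<..<m}" "1 < (1 - m) / (1 + m) * exp (8 * \<beta> * a ^ 3)"
    using eventually_happens' trivial_limit_at_left_real by blast
  with m that show ?thesis by auto
qed

theorem lemma1p3:
  fixes \<beta> \<epsilon> :: real
  assumes "\<beta> > 0" and "\<beta> > \<beta>_threshold" and "0 < \<epsilon>" and "\<epsilon> < 1 / 2"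
  shows "\<exists>c>0. \<forall>\<^sub>F n in sequentially.
           ereal (exp (c * real n)) \<le>
             ereal_of_enat (mixing_time (spins n) (glauber n (tensor_curie_weiss n \<beta>))
               (tensor_curie_weiss n \<beta>) \<epsilon>)"
proof -
  obtain a m where am: "0 < a" "a < m" "m < 1" "1 < (1 - m) / (1 + m) * exp (8 * \<beta> * a ^ 3)"
    using threshold_interval[OF assms(2)] by blast
  define r where "r = (1 - m) / (1 + m) * exp (8 * \<beta> * a ^ 3)"
  have r: "r > 1" using am by (simp add: r_def)
  \<comment> \<open>About \<open>(m - a) / 2 * n\<close> levels each gain a factor \<open>r\<close>.
    Half of that exponent is given up to absorb rounding and the factor
    \<open>1 / 2 - \<epsilon>\<close>.\<close>
  define c where "c = (m - a) / 4 * ln r"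
  have c: "c > 0" using r am by (simp add: c_def)
  have lim: "filterlim (\<lambda>n. (m - a) / 4 * real n) at_top sequentially"
    using am by (intro filterlim_tendsto_pos_mult_at_top[OF tendsto_const _ filterlim_real_sequentially]) auto
  \<comment> \<open>The entry 2 yields \<open>k < l\<close> below; the other pays for the rounding
    loss 2 and for \<open>1 / 2 - \<epsilon>\<close>.\<close>
  have "\<forall>\<^sub>F n in sequentially. (m - a) / 4 * real n \<ge> max 2 (2 - ln (1 / 2 - \<epsilon>) / ln r)"
    using lim by (simp only: filterlim_at_top)
  then have "\<forall>\<^sub>F n in sequentially. ereal (exp (c * real n)) \<le>
             ereal_of_enat (mixing_time (spins n) (glauber n (tensor_curie_weiss n \<beta>))
               (tensor_curie_weiss n \<beta>) \<epsilon>)"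
  proof eventually_elim
    case (elim n)
    \<comment> \<open>Mean spin \<open>a\<close> means \<open>(1 + a) * n / 2\<close> spins up.
      Rounding goes inward, so levels \<open>k\<close> to \<open>l\<close> stay within mean spin
      \<open>[a, m]\<close>; each end loses less than one level.\<close>
    define k where "k = nat \<lceil>(1 + a) * real n / 2\<rceil>"
    define l where "l = nat \<lfloor>(1 + m) * real n / 2\<rfloor>"
    have n: "n > 0" using elim by (cases n) auto
    have k: "(1 + a) * real n / 2 \<le> real k" "real k < (1 + a) * real n / 2 + 1"
      using am unfolding k_def by (simp_all, linarith+)
    have l: "real l \<le> (1 + m) * real n / 2" "(1 + m) * real n / 2 - 1 < real l"
      using am unfolding l_def by (simp_all, linarith+)
    have gap: "(m - a) / 2 * real n - 2 < real l - real k"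
      using k l by (simp add: field_simps)
    have "(m - a) / 4 * real n \<ge> 2" using elim by (simp only: max.bounded_iff)
    with gap have "real k < real l" by simp
    then have kl: "k \<le> l" by simp
    have "0 < a * real n" using am n by simp
    then have "n < 2 * k" using k(1) by (simp add: field_simps)
    moreover have "m * real n < real n" using am n by simp
    then have "l \<le> n" using l(1) by (simp add: field_simps)
    moreover have "r * level_weight n \<beta> j \<le> level_weight n \<beta> (Suc j)" if "k \<le> j" "Suc j \<le> l" for j
      unfolding r_def
    proof (rule level_weight_Suc_ge[OF assms(1) am(1) am(3)])
      show "(1 + a) * real n \<le> 2 * real j" using k(1) that(1) by simp
      have "real (Suc j) \<le> real l" using that(2) by (simp only: of_nat_le_iff)
      with l(1) show "2 * real (Suc j) \<le> (1 + m) * real n" by simp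
    qed
    ultimately have mix: "ereal ((1 / 2 - \<epsilon>) * r ^ (l - k)) \<le>
        ereal_of_enat (mixing_time (spins n) (glauber n (tensor_curie_weiss n \<beta>))
          (tensor_curie_weiss n \<beta>) \<epsilon>)"
      using n kl r assms by (intro mixing_time_level_bound) auto
    have "2 - ln (1 / 2 - \<epsilon>) / ln r \<le> (m - a) / 4 * real n"
      using elim by (simp only: max.bounded_iff)
    moreover have "(m - a) / 2 * real n = (m - a) / 4 * real n + (m - a) / 4 * real n"
      by (simp add: field_simps)
    moreover have "real (l - k) = real l - real k" using kl by (rule of_nat_diff)
    ultimately have "(m - a) / 4 * real n - ln (1 / 2 - \<epsilon>) / ln r \<le> real (l - k)"
      using gap by linarith
    then have "((m - a) / 4 * real n - ln (1 / 2 - \<epsilon>) / ln r) * ln r \<le> real (l - k) * ln r"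
      using r by (intro mult_right_mono) auto
    then have "c * real n \<le> ln (1 / 2 - \<epsilon>) + real (l - k) * ln r"
      using r by (simp add: c_def algebra_simps)
    also have "\<dots> = ln ((1 / 2 - \<epsilon>) * r ^ (l - k))"
      using r assms by (simp add: ln_mult ln_realpow)
    finally have "exp (c * real n) \<le> (1 / 2 - \<epsilon>) * r ^ (l - k)"
      using r assms by (simp add: ln_ge_iff)
    with mix show ?case by (meson ereal_less_eq(3) order_trans)
  qed
  with c show ?thesis by blast
qed

end
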